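(* Let $V:\mathbb{R}^n\to\mathbb{R}$ be a smooth, bounded, increasing radially symmetric potential, i.e. $V(x)=v(|x|)$ with $v'(r)>0$ for $r>0$. Let $f_0,f_1\in C(\mathbb{R}^n)$ be two distinct, non-negative, symmetric decreasing functions with unit mass, and let $f_t$, $0\le t\le1$, be the height function interpolation between $f_0$ and $f_1$. Then $$t\mapsto\int_{\mathbb{R}^n}V(x)f_t(x)\,dx$$ is strictly convex for all $0<t<1$.
   Context: Symmetric decreasing means $f(x)=\Phi(|x|)$ with $\Phi$ non-increasing; unit mass means $\int_{\mathbb{R}^n}f\,dx=1$. Height function: for a non-negative symmetric decreasing $f$ of unit mass, the height function $H:(0,1)\to(0,\|f\|_{L^\infty(\mathbb{R}^n)})$ is defined implicitly by $\int_{\mathbb{R}^n}\min\{f(x),H(m)\}\,dx=m$ for $m\in(0,1)$. It is continuous, strictly increasing and convex, and determines $f$ through $$f(x)=\int_0^1\chi_{B(0,(c_nH'(m))^{-1/n})}(x)\,H'(m)\,dm,$$ where $c_n$ is the volume of the unit ball of $\mathbb{R}^n$. Height function interpolation: if $H_0,H_1$ are the height functions of $f_0,f_1$, set $H_t=(1-t)H_0+tH_1$ for $t\in[0,1]$; $f_t$ is the symmetric decreasing function of unit mass whose height function is $H_t$, i.e. given by the displayed formula with $H$ replaced by $H_t$. *)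

theory Defs
  imports "HOL-Probability.Essential_Supremum"
begin

primrec times_cont_differentiable :: "nat \<Rightarrow> (real ^ 'n \<Rightarrow> real) \<Rightarrow> bool" where
  "times_cont_differentiable 0 f \<longleftrightarrow> continuous_on UNIV f"
| "times_cont_differentiable (Suc k) f \<longleftrightarrow>
     (\<forall>x. f differentiable (at x)) \<and>
     (\<forall>v. times_cont_differentiable k (\<lambda>x. frechet_derivative f (at x) v))"

definition smooth :: "(real ^ 'n \<Rightarrow> real) \<Rightarrow> bool" where
  "smooth f \<longleftrightarrow> (\<forall>k. times_cont_differentiable k f)"

definition increasing_radially_symmetric :: "(real ^ 'n \<Rightarrow> real) \<Rightarrow> bool" where
  "increasing_radially_symmetric V \<longleftrightarrow>
     (\<exists>v v'. (\<forall>x. V x = v (norm x)) \<and>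
             (\<forall>r>0. (v has_real_derivative v' r) (at r) \<and> v' r > 0))"

definition symmetric_decreasing :: "(real ^ 'n \<Rightarrow> real) \<Rightarrow> bool" where
  "symmetric_decreasing f \<longleftrightarrow>
     (\<exists>\<Phi>. antimono_on {0..} \<Phi> \<and> (\<forall>x. f x = \<Phi> (norm x)))"

definition unit_mass :: "(real ^ 'n \<Rightarrow> real) \<Rightarrow> bool" where
  "unit_mass f \<longleftrightarrow> has_bochner_integral lborel f 1"

text \<open>The \<open>L\<^sup>\<infinity>\<close> norm is extended real valued, since a symmetric decreasing function
  may be unbounded at the origin.  Only the values at \<open>m\<close> in the open unit interval
  are meaningful.\<close>

definition height :: "(real ^ 'n \<Rightarrow> real) \<Rightarrow> real \<Rightarrow> real" where
  "height f m = (THE h. 0 < h \<and> ereal h < esssup lborel (\<lambda>x. ereal \<bar>f x\<bar>) \<and>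
                        (LINT x|lborel. min (f x) h) = m)"

text \<open>A height function is convex, so it is differentiable in the open unit interval off a
  countable set; the unspecified value of \<^const>\<open>deriv\<close> there does not affect the integral.\<close>

definition of_height :: "(real \<Rightarrow> real) \<Rightarrow> real ^ 'n \<Rightarrow> real" where
  "of_height H x =
     (LINT m:{0<..<1}|lborel.
        indicator (ball 0 ((measure lborel (ball (0 :: real ^ 'n) 1) * deriv H m)
                             powr (- 1 / real CARD('n)))) x * deriv H m)"

definition height_interpolation ::
    "(real ^ 'n \<Rightarrow> real) \<Rightarrow> (real ^ 'n \<Rightarrow> real) \<Rightarrow> real \<Rightarrow> real ^ 'n \<Rightarrow> real" where
  "height_interpolation f0 f1 t = of_height (\<lambda>m. (1 - t) * height f0 m + t * height f1 m)"

definition strictly_convex_on :: "real set \<Rightarrow> (real \<Rightarrow> real) \<Rightarrow> bool" where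
  "strictly_convex_on S F \<longleftrightarrow> convex S \<and>
     (\<forall>x\<in>S. \<forall>y\<in>S. \<forall>u\<in>{0<..<1}. x \<noteq> y \<longrightarrow>
        F ((1 - u) * x + u * y) < (1 - u) * F x + u * F y)"

end

theory Submission
  imports Defs
begin

text \<open>By Fubini, the energy of \<open>f\<^sub>t\<close> is the integral over \<open>m\<close> of \<open>G (H\<^sub>t' m)\<close>, where \<open>G h\<close> is the
  energy of the slab of height \<open>h\<close> supported on the centred ball of volume \<open>1 / h\<close>.  The function \<open>G\<close>
  is strictly convex by the bathtub principle, and \<open>H\<^sub>t'\<close> is affine in \<open>t\<close>, so it remains to see that
  \<open>H\<^sub>0'\<close> and \<open>H\<^sub>1'\<close> differ on a set of positive measure.  Otherwise \<open>H\<^sub>0 = H\<^sub>1\<close>, as both are convex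
  and vanish at \<open>0\<close>, and the height function determines the density.\<close>

section \<open>Measure of open sets and strict monotonicity of integrals\<close>

lemma open_lborel_pos:
  fixes S :: "'a::euclidean_space set"
  assumes "open S" "x \<in> S"
  shows "0 < emeasure lborel S"
proof -
  obtain e where e: "e > 0" "ball x e \<subseteq> S"
    using assms open_contains_ball by blast
  have "0 < measure lborel (ball x e)"
    using content_ball_pos[OF e(1)] by simp
  then have "0 < emeasure lborel (ball x e)"
    by (simp add: measure_def enn2real_positive_iff)
  also have "\<dots> \<le> emeasure lborel S"
    using e assms by (intro emeasure_mono) auto
  finally show ?thesis .
qed

text \<open>A nonnegative integrable function with zero integral vanishes almost everywhere, applied
  here to \<open>g - f\<close>. This turns pointwise strictness on a non-null set into strictness of
  integrals, first for the bathtub principle and then for the final convexity estimate.\<close>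

lemma integral_strict_mono_AE:
  fixes f g :: "'a \<Rightarrow> real"
  assumes f: "integrable M f" and g: "integrable M g"
    and le: "AE x in M. f x \<le> g x"
    and pos: "\<not> (AE x in M. f x = g x)"
  shows "integral\<^sup>L M f < integral\<^sup>L M g"
proof -
  have "AE x in M. 0 \<le> g x - f x"
    using le by auto
  moreover have "\<not> (AE x in M. g x - f x = 0)"
  proof
    assume "AE x in M. g x - f x = 0"
    then have "AE x in M. f x = g x"
      by (rule eventually_mono) simp
    with pos show False ..
  qed
  ultimately have "integral\<^sup>L M (\<lambda>x. g x - f x) \<noteq> 0"
    using integral_nonneg_eq_0_iff_AE[of M "\<lambda>x. g x - f x"] f g by simp
  moreover have "integral\<^sup>L M f \<le> integral\<^sup>L M g"
    using f g le by (rule integral_mono_AE)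
  ultimately show ?thesis
    using f g by simp
qed

section \<open>Symmetric densities: superlevel sets and truncated mass\<close>

locale symmetric_density =
  fixes f :: "real ^ 'n \<Rightarrow> real"
  assumes cont: "continuous_on UNIV f"
    and nonneg: "0 \<le> f x"
    and symm: "symmetric_decreasing f"
    and mass: "unit_mass f"
begin

lemma antimono_norm: "norm x \<le> norm y \<Longrightarrow> f y \<le> f x"
  using symm unfolding symmetric_decreasing_def monotone_on_def by auto

lemma le_centre: "f x \<le> f 0"
  by (rule antimono_norm) simp

lemma integrable: "integrable lborel f" and integral_one: "integral\<^sup>L lborel f = 1"
  using mass by (auto simp: unit_mass_def has_bochner_integral_iff)

lemma measurable [measurable]: "f \<in> borel_measurable borel"
  using cont by (rule borel_measurable_continuous_onI)

lemma centre_pos: "0 < f 0"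
proof (rule ccontr)
  assume "\<not> 0 < f 0"
  then have "f = (\<lambda>x. 0)"
    using le_centre nonneg by (metis antisym linorder_not_less order_trans)
  then have "integral\<^sup>L lborel f = 0"
    by simp
  then show False
    using integral_one by simp
qed

lemma open_superlevel: "open {x. h < f x}"
  using open_Collect_less[OF continuous_on_const cont] .

text \<open>Chebyshev's inequality: the indicator is dominated by \<open>f x / h\<close>.\<close>

lemma integrable_superlevel:
  assumes "0 < h"
  shows "integrable lborel (indicator {x. h < f x} :: _ \<Rightarrow> real)"
proof (rule Bochner_Integration.integrable_bound)
  show "integrable lborel (\<lambda>x. f x / h)"
    using integrable by simp
  show "AE x in lborel. norm (indicator {x. h < f x} x :: real) \<le> norm (f x / h)"
    using assms nonneg by (auto simp: indicator_def field_simps)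
qed measurable

lemma superlevel_finite:
  assumes "0 < h"
  shows "emeasure lborel {x. h < f x} < \<infinity>"
  using integrable_superlevel[OF assms] by (simp add: integrable_indicator_iff)

definition superlevel :: "real \<Rightarrow> real" where
  "superlevel h = measure lborel {x. h < f x}"

lemma superlevel_pos:
  assumes "0 < h" "h < f 0"
  shows "0 < superlevel h"
  unfolding superlevel_def measure_def
  using open_lborel_pos[OF open_superlevel, of 0 h] superlevel_finite[OF assms(1)] assms
  by (simp add: enn2real_positive_iff)

lemma superlevel_antimono:
  assumes "0 < h" "h \<le> k"
  shows "superlevel k \<le> superlevel h"
  unfolding superlevel_def
  by (rule measure_mono_fmeasurable)
     (use assms superlevel_finite[OF assms(1)] in \<open>auto simp: fmeasurable_def\<close>)

text \<open>The mass of \<open>f\<close> below height \<open>h\<close>. It maps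
  \<open>{0<..<f 0}\<close> onto \<open>{0<..<1}\<close>, and \<open>height f\<close> is the inverse
  of that map.\<close>

definition layer :: "real \<Rightarrow> real" where
  "layer h = (LINT x|lborel. min (f x) h)"

lemma integrable_min:
  assumes "0 \<le> h"
  shows "integrable lborel (\<lambda>x. min (f x) h)"
  by (rule Bochner_Integration.integrable_bound[OF integrable]) (use assms nonneg in auto)

text \<open>The integrand \<open>min (f x) k - min (f x) h\<close> equals \<open>k - h\<close> where
  \<open>k < f x\<close> and vanishes unless \<open>h < f x\<close>. So \<open>superlevel\<close>
  acts as the derivative of \<open>layer\<close>, and its monotonicity makes \<open>layer\<close>
  concave.\<close>

lemma layer_diff:
  assumes "0 < h" "h < k"
  shows "(k - h) * superlevel k \<le> layer k - layer h"
    and "layer k - layer h \<le> (k - h) * superlevel h"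
proof -
  have eq: "layer k - layer h = (LINT x|lborel. min (f x) k - min (f x) h)"
    unfolding layer_def using assms by (simp add: integrable_min)
  have ind: "(k - h) * superlevel s = (LINT x|lborel. (k - h) * indicator {x. s < f x} x)" for s
    unfolding superlevel_def by simp
  have int: "integrable lborel (\<lambda>x. min (f x) k - min (f x) h)"
    "0 < s \<Longrightarrow> integrable lborel (\<lambda>x. (k - h) * indicator {x. s < f x} x)" for s
    using assms integrable_superlevel by (auto simp: integrable_min)
  show "(k - h) * superlevel k \<le> layer k - layer h"
    unfolding eq ind by (rule integral_mono[OF int(2,1)]) (use assms in \<open>auto simp: indicator_def\<close>)
  show "layer k - layer h \<le> (k - h) * superlevel h"
    unfolding eq ind by (rule integral_mono[OF int(1,2)]) (use assms in \<open>auto simp: indicator_def\<close>)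
qed

lemma layer_zero: "layer 0 = 0"
  using nonneg by (simp add: layer_def min_absorb2)

lemma layer_centre: "layer (f 0) = 1"
  using le_centre integral_one by (simp add: layer_def min_absorb1)

lemma continuous_on_layer: "continuous_on {0..} layer"
proof (rule continuous_on_sequentiallyI)
  fix u :: "nat \<Rightarrow> real" and a assume u: "\<forall>n. u n \<in> {0..}" and a: "a \<in> {0..}" and lim: "u \<longlonglongrightarrow> a"
  show "(\<lambda>n. layer (u n)) \<longlonglongrightarrow> layer a"
    unfolding layer_def
  proof (rule integral_dominated_convergence[where w = f])
    show "AE x in lborel. (\<lambda>n. min (f x) (u n)) \<longlonglongrightarrow> min (f x) a"
      using lim by (auto intro!: tendsto_intros)
    show "AE x in lborel. norm (min (f x) (u n)) \<le> f x" for n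
    proof (rule AE_I2)
      fix x
      have "0 \<le> u n"
        using u by simp
      then show "norm (min (f x) (u n)) \<le> f x"
        using nonneg[of x] by (simp add: min_def)
    qed
  qed (use integrable in auto)
qed

lemma layer_mono:
  assumes "0 \<le> h" "h \<le> k"
  shows "layer h \<le> layer k"
  unfolding layer_def by (rule integral_mono) (use assms integrable_min in auto)

lemma layer_strict_mono:
  assumes "0 \<le> h" "h < k" "k \<le> f 0"
  shows "layer h < layer k"
proof -
  \<comment> \<open>Two interior points avoid the endpoints: \<open>layer_diff\<close> wants a
    positive lower height although \<open>h\<close> may be \<open>0\<close>, and
    \<open>superlevel_pos\<close> wants a height below \<open>f 0\<close> although \<open>k\<close>
    may equal it.\<close>
  define a b where "a = (2 * h + k) / 3" and "b = (h + 2 * k) / 3"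
  have ab: "h < a" "0 < a" "a < b" "b < k" "0 < b" "b < f 0"
    using assms by (auto simp: a_def b_def)
  have "layer h \<le> layer a"
    using assms ab by (intro layer_mono) auto
  also have "layer a < layer b"
    using layer_diff(1)[of a b] superlevel_pos[of b] ab
    by (smt (verit, best) mult_pos_pos)
  also have "layer b \<le> layer k"
    using assms ab by (intro layer_mono) auto
  finally show ?thesis .
qed

section \<open>The height function as the inverse of the truncated mass\<close>

text \<open>The essential supremum is \<open>f 0\<close>: this value is the maximum, and by
  continuity each superlevel set below it is open and contains the origin, hence has positive
  measure.\<close>

lemma less_esssup_iff:
  assumes "0 \<le> h"
  shows "ereal h < esssup lborel (\<lambda>x. ereal \<bar>f x\<bar>) \<longleftrightarrow> h < f 0"
proof
  have "esssup lborel (\<lambda>x. ereal \<bar>f x\<bar>) \<le> ereal (f 0)"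
    using le_centre nonneg by (intro esssup_I) auto
  then show "ereal h < esssup lborel (\<lambda>x. ereal \<bar>f x\<bar>) \<Longrightarrow> h < f 0"
    using less_le_trans by fastforce
next
  assume h: "h < f 0"
  show "ereal h < esssup lborel (\<lambda>x. ereal \<bar>f x\<bar>)"
  proof (rule ccontr)
    assume "\<not> ereal h < esssup lborel (\<lambda>x. ereal \<bar>f x\<bar>)"
    then have le: "esssup lborel (\<lambda>x. ereal \<bar>f x\<bar>) \<le> ereal h"
      by simp
    have "AE x in lborel. ereal \<bar>f x\<bar> \<le> ereal h"
      by (rule eventually_mono[OF esssup_AE]) (erule order_trans[OF _ le])
    then have "AE x in lborel. \<not> h < f x"
      by (rule eventually_mono) auto
    then have "emeasure lborel {x. h < f x} = 0"
      using AE_iff_null_sets[of "{x. h < f x}" lborel] by (simp add: null_sets_def)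
    then show False
      using open_lborel_pos[OF open_superlevel, of 0 h] h by simp
  qed
qed

text \<open>Strict monotonicity of \<open>layer\<close> leaves only one candidate for the definite
  description in \<open>height\<close>.\<close>

lemma height_unique:
  assumes "0 < h" "h < f 0" "layer h = m"
  shows "height f m = h"
  unfolding height_def
proof (rule the_equality)
  show "0 < h \<and> ereal h < esssup lborel (\<lambda>x. ereal \<bar>f x\<bar>) \<and> (LINT x|lborel. min (f x) h) = m"
    using assms less_esssup_iff[of h] by (simp add: layer_def)
next
  fix k
  assume "0 < k \<and> ereal k < esssup lborel (\<lambda>x. ereal \<bar>f x\<bar>) \<and> (LINT x|lborel. min (f x) k) = m"
  then have "0 < k" "k < f 0" "layer k = m"
    using less_esssup_iff[of k] by (auto simp: layer_def)
  then show "k = h"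
    using layer_strict_mono[of k h] layer_strict_mono[of h k] assms
    by (cases k h rule: linorder_cases) auto
qed

text \<open>Existence is the intermediate value theorem: \<open>layer\<close> is continuous and goes
  from \<open>0\<close> at \<open>0\<close> to \<open>1\<close> at \<open>f 0\<close>.\<close>

lemma height_props:
  assumes "0 < m" "m < 1"
  shows height_pos: "0 < height f m" and height_less: "height f m < f 0"
    and layer_height: "layer (height f m) = m"
proof -
  obtain h where h: "0 \<le> h" "h \<le> f 0" "layer h = m"
    using IVT'[of layer 0 m "f 0"] assms layer_zero layer_centre centre_pos
      continuous_on_subset[OF continuous_on_layer, of "{0..f 0}"] by auto
  then have "0 < h" "h < f 0"
    using assms layer_zero layer_centre by (auto simp: less_le)
  with h show "0 < height f m" "height f m < f 0" "layer (height f m) = m"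
    using height_unique[of h m] by auto
qed

lemma height_strict_mono:
  assumes "0 < m" "m < l" "l < 1"
  shows "height f m < height f l"
  using layer_mono[of "height f l" "height f m"] height_props[of m] height_props[of l] assms
  by force

section \<open>The slope of the height function\<close>

text \<open>The derivative that the inverse function rule predicts for \<open>height f\<close>.
  Unlike \<open>deriv\<close>, it keeps a meaningful value at the kinks in the unit
  interval.\<close>

definition slope :: "real \<Rightarrow> real" where
  "slope m = 1 / superlevel (height f m)"

lemma slope_pos: "0 < m \<Longrightarrow> m < 1 \<Longrightarrow> 0 < slope m"
  by (simp add: slope_def superlevel_pos height_props)

text \<open>This is the convexity of the height function: heights grow with the mass, and superlevel
  sets shrink as the height grows.\<close>

lemma slope_mono: "mono_on {0<..<1} slope"
proof (rule mono_onI)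
  fix x y :: real assume *: "x \<in> {0<..<1}" "y \<in> {0<..<1}" "x \<le> y"
  show "slope x \<le> slope y"
  proof (cases "x = y")
    case False
    then have "height f x < height f y"
      using * by (intro height_strict_mono) auto
    then have "superlevel (height f y) \<le> superlevel (height f x)"
      using * height_pos[of x] by (intro superlevel_antimono) auto
    moreover have "0 < superlevel (height f y)"
      using * by (simp add: superlevel_pos height_props)
    ultimately show ?thesis
      unfolding slope_def by (intro divide_left_mono) auto
  qed simp
qed

text \<open>\<open>layer_diff\<close> read through the inverse. The two bounds together say that
  \<open>slope\<close> is a subgradient of \<open>height f\<close> at every point of the unit
  interval.\<close>

lemma height_diff:
  assumes "0 < x" "x < y" "y < 1"
  shows "(y - x) * slope x \<le> height f y - height f x"
    and "height f y - height f x \<le> (y - x) * slope y"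
proof -
  have lt: "height f x < height f y" "0 < height f x"
    using assms by (auto intro: height_strict_mono height_pos)
  have pos: "0 < superlevel (height f x)" "0 < superlevel (height f y)"
    using assms by (simp_all add: superlevel_pos height_props)
  have *: "layer (height f x) = x" "layer (height f y) = y"
    using assms by (simp_all add: layer_height)
  show "(y - x) * slope x \<le> height f y - height f x"
    using layer_diff(2)[OF lt(2,1)] pos by (simp add: * slope_def field_simps)
  show "height f y - height f x \<le> (y - x) * slope y"
    using layer_diff(1)[OF lt(2,1)] pos by (simp add: * slope_def field_simps)
qed

text \<open>A difference quotient lies between the slopes at its two ends, so continuity of
  \<open>slope\<close> squeezes it. Taking \<open>min\<close> and \<open>max\<close> treats both
  sides of \<open>m\<close> at once.\<close>

lemma DERIV_height:
  assumes m: "0 < m" "m < 1" and "isCont slope m"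
  shows "(height f has_real_derivative slope m) (at m)"
  unfolding has_field_derivative_iff
proof (rule tendsto_sandwich)
  have lim: "slope \<midarrow>m\<rightarrow> slope m"
    using assms by (simp add: isCont_def)
  show "(\<lambda>y. min (slope y) (slope m)) \<midarrow>m\<rightarrow> slope m"
    using tendsto_min[OF lim tendsto_const, of "slope m"] by simp
  show "(\<lambda>y. max (slope y) (slope m)) \<midarrow>m\<rightarrow> slope m"
    using tendsto_max[OF lim tendsto_const, of "slope m"] by simp
  have ev: "eventually (\<lambda>y. y \<in> {0<..<1} - {m}) (at m)"
    using m by (intro eventually_at_in_open) auto
  have bounds: "min (slope y) (slope m) \<le> (height f y - height f m) / (y - m) \<and>
        (height f y - height f m) / (y - m) \<le> max (slope y) (slope m)"
    if "y \<in> {0<..<1} - {m}" for y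
  proof (cases "m < y")
    case True
    then have "slope m \<le> (height f y - height f m) / (y - m)"
      "(height f y - height f m) / (y - m) \<le> slope y"
      using height_diff[of m y] that m by (auto simp: field_simps)
    then show ?thesis by auto
  next
    case False
    then have *: "y < m" "0 < m - y" using that by auto
    have "(height f y - height f m) / (y - m) = (height f m - height f y) / (m - y)"
      by (metis minus_diff_eq minus_divide_divide)
    moreover have "slope y \<le> (height f m - height f y) / (m - y)"
      "(height f m - height f y) / (m - y) \<le> slope m"
      using height_diff[of y m] that m * by (auto simp: field_simps)
    ultimately show ?thesis by auto
  qed
  show "\<forall>\<^sub>F y in at m. min (slope y) (slope m) \<le> (height f y - height f m) / (y - m)"
    "\<forall>\<^sub>F y in at m. (height f y - height f m) / (y - m) \<le> max (slope y) (slope m)"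
    by (rule eventually_mono[OF ev], use bounds in blast)+
qed

text \<open>Together with \<open>DERIV_height\<close>, this lets \<open>slope\<close> replace
  \<open>deriv\<close> under the integral in \<open>of_height\<close>.\<close>

lemma countable_discontinuities: "countable {m \<in> {0<..<1}. \<not> isCont slope m}"
  by (rule mono_on_ctble_discont_open[OF open_greaterThanLessThan slope_mono])

lemma layer_in_unit:
  assumes "0 < h" "h < f 0"
  shows "0 < layer h" "layer h < 1" "height f (layer h) = h"
  using layer_strict_mono[of 0 h] layer_strict_mono[of h "f 0"] assms height_unique[OF assms]
  by (auto simp: layer_zero layer_centre)

text \<open>The height function tends to \<open>0\<close> at \<open>0\<close>; this fixes the
  additive constant once two height functions are known to have the same slopes.\<close>

lemma height_less_near_zero:
  assumes "0 < e"
  shows "\<exists>d>0. \<forall>m. 0 < m \<longrightarrow> m < d \<longrightarrow> m < 1 \<longrightarrow> height f m < e"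
proof (intro exI conjI allI impI)
  \<comment> \<open>Capping at \<open>f 0 / 2\<close> keeps \<open>a\<close> in the range of the
    height function, so that \<open>layer a\<close> serves as the threshold.\<close>
  define a where "a = min e (f 0 / 2)"
  have a: "0 < a" "a < f 0" "a \<le> e"
    using assms centre_pos by (auto simp: a_def)
  show "0 < layer a"
    using layer_in_unit[OF a(1,2)] by simp
  fix m assume "0 < m" "m < layer a" "m < 1"
  then have "height f m < height f (layer a)"
    using a layer_in_unit[of a] by (intro height_strict_mono) auto
  then show "height f m < e"
    using a layer_in_unit[of a] by simp
qed

end

section \<open>Slabs and their energy\<close>

text \<open>For positive \<open>h\<close>, the radius of the ball of volume \<open>1 / h\<close>.
  The type argument supplies the dimension, which a function on the reals does not
  determine.\<close>

definition radius :: "'n::finite itself \<Rightarrow> real \<Rightarrow> real" where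
  "radius _ h = (measure lborel (ball (0 :: real ^ 'n) 1) * h) powr (- 1 / real CARD('n))"

text \<open>The integrand of \<open>of_height\<close> where the derivative has the value
  \<open>h\<close>; for \<open>h > 0\<close> it is a uniform probability density.\<close>

definition slab :: "real \<Rightarrow> real ^ 'n::finite \<Rightarrow> real" where
  "slab h x = indicator (ball 0 (radius TYPE('n) h)) x * h"

definition slab_energy :: "(real ^ 'n::finite \<Rightarrow> real) \<Rightarrow> real \<Rightarrow> real" where
  "slab_energy V h = (LINT x|lborel. V x * slab h x)"

lemma radius_pos:
  assumes "0 < h"
  shows "0 < radius TYPE('n::finite) h"
  using assms content_ball_pos[of 1 "0 :: real ^ 'n"] by (simp add: radius_def)

lemma radius_strict_antimono:
  assumes "0 < h" "h < k"
  shows "radius TYPE('n::finite) k < radius TYPE('n) h"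
  using assms content_ball_pos[of 1 "0 :: real ^ 'n"]
  unfolding radius_def by (intro powr_less_mono2_neg) (auto simp: divide_neg_pos)

lemma measure_radius_ball:
  assumes "0 < h"
  shows "measure lborel (ball (0 :: real ^ 'n) (radius TYPE('n::finite) h)) = 1 / h"
proof -
  define c where "c = measure lborel (ball (0 :: real ^ 'n) 1)"
  have c: "0 < c"
    unfolding c_def by (rule content_ball_pos) simp
  have c_eq: "c = unit_ball_vol (real DIM(real ^ 'n))"
    unfolding c_def using content_ball[of 1 "0 :: real ^ 'n"] by simp
  have r: "0 < radius TYPE('n) h"
    using assms by (rule radius_pos)
  have "radius TYPE('n) h ^ CARD('n) = radius TYPE('n) h powr real CARD('n)"
    using r by (simp add: powr_realpow)
  also have "\<dots> = (c * h) powr (- 1)"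
    by (simp add: radius_def c_def powr_powr)
  also have "\<dots> = 1 / (c * h)"
    using c assms by (simp add: powr_minus_divide)
  finally show ?thesis
    using content_ball[of "radius TYPE('n) h" "0 :: real ^ 'n"] c r by (auto simp: c_eq)
qed

lemma slab_nonneg: "0 \<le> h \<Longrightarrow> 0 \<le> slab h x"
  by (simp add: slab_def)

lemma slab_zero [simp]: "slab 0 x = 0"
  by (simp add: slab_def)

lemma slab_eq: "slab h (x :: real ^ 'n) = (if norm x < radius TYPE('n::finite) h then h else 0)"
  by (simp add: slab_def indicator_def)

lemma measurable_radius [measurable]: "radius TYPE('n::finite) \<in> borel_measurable borel"
  unfolding radius_def by measurable

text \<open>Joint measurability in height and position, as Fubini requires.\<close>

lemma measurable_slab [measurable]:
  assumes [measurable]: "e \<in> borel_measurable M" "g \<in> borel_measurable M"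
  shows "(\<lambda>z. slab (e z) (g z :: real ^ 'n::finite)) \<in> borel_measurable M"
  unfolding slab_eq by measurable

lemma integrable_slab: "integrable lborel (slab h :: real ^ 'n::finite \<Rightarrow> real)"
  unfolding slab_def using emeasure_lborel_ball_finite[of 0 "radius TYPE('n) h"]
  by (intro integrable_mult_left) (simp add: integrable_indicator_iff)

lemma integral_slab:
  assumes "0 < h"
  shows "(LINT x|lborel. slab h (x :: real ^ 'n::finite)) = 1"
  using measure_radius_ball[OF assms, where 'n = 'n] assms by (simp add: slab_def)

lemma integrable_times_slab:
  assumes [measurable]: "V \<in> borel_measurable borel" and C: "\<And>x. \<bar>V x\<bar> \<le> C"
  shows "integrable lborel (\<lambda>x. V x * slab h (x :: real ^ 'n::finite))"
proof (rule Bochner_Integration.integrable_bound)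
  show "integrable lborel (\<lambda>x. C * slab h (x :: real ^ 'n))"
    using integrable_slab by (rule integrable_mult_right)
  show "AE x in lborel. norm (V x * slab h x) \<le> norm (C * slab h x)"
  proof (rule AE_I2)
    fix x
    have "\<bar>V x\<bar> \<le> \<bar>C\<bar>"
      using C[of x] by linarith
    then show "norm (V x * slab h x) \<le> norm (C * slab h x)"
      by (simp add: abs_mult mult_right_mono)
  qed
qed measurable

text \<open>The slab has unit mass, so its energy is an average of \<open>V\<close>.\<close>

lemma abs_slab_energy_le:
  fixes V :: "real ^ 'n::finite \<Rightarrow> real"
  assumes "V \<in> borel_measurable borel" and C: "\<And>x. \<bar>V x\<bar> \<le> C" and "0 < h"
  shows "\<bar>slab_energy V h\<bar> \<le> C"
proof -
  have "\<bar>slab_energy V h\<bar> \<le> (LINT x|lborel. \<bar>V x * slab h x\<bar>)"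
    unfolding slab_energy_def by (rule integral_abs_bound)
  also have "\<dots> \<le> (LINT x|lborel. C * slab h (x :: real ^ 'n))"
  proof (rule integral_mono)
    show "\<bar>V x * slab h x\<bar> \<le> C * slab h x" for x
      using C[of x] slab_nonneg[of h x] assms(3) by (simp add: abs_mult mult_right_mono)
  qed (use integrable_times_slab[OF assms(1,2)] integrable_slab in auto)
  also have "\<dots> = C"
    using integral_slab[OF assms(3), where 'n = 'n] by simp
  finally show ?thesis .
qed

text \<open>Bathtub principle: among densities bounded by \<open>h\<close>, the slab of height \<open>h\<close> has the least
  energy.  The competitor is the convex combination of the slabs of heights \<open>h0\<close> and \<open>h1\<close>; both have
  unit mass, so \<open>V\<close> may be replaced by its difference from the boundary value of the ball.\<close>

lemma slab_energy_strict_convex_less: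
  fixes V :: "real ^ 'n::finite \<Rightarrow> real"
  assumes meas [measurable]: "V \<in> borel_measurable borel" and C: "\<And>x. \<bar>V x\<bar> \<le> C"
    and V: "\<And>x. V x = v (norm x)" and v: "\<And>r s. 0 < r \<Longrightarrow> r < s \<Longrightarrow> v r < v s"
    and h: "0 < h0" "h0 < h1" and a: "0 < a" "0 < b" "a + b = 1"
  shows "slab_energy V (a * h0 + b * h1) < a * slab_energy V h0 + b * slab_energy V h1"
proof -
  define h where "h = a * h0 + b * h1"
  have "a = 1 - b"
    using a(3) by simp
  have "h = h0 + b * (h1 - h0)"
    unfolding h_def \<open>a = 1 - b\<close> by (simp add: algebra_simps)
  moreover have "0 < b * (h1 - h0)"
    using h a by simp
  ultimately have h0h: "h0 < h"
    by linarith
  have hpos: "0 < h"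
    using h0h h by simp
  define R where "R = radius TYPE('n) h"
  define w where "w x = a * slab h0 x + b * slab h1 x" for x :: "real ^ 'n"
  have R: "0 < R" "R < radius TYPE('n) h0"
    using radius_pos[OF hpos, where 'n = 'n] radius_strict_antimono[OF h(1) h0h, where 'n = 'n]
    by (auto simp: R_def)
  have int: "integrable lborel (\<lambda>x. V x * slab k x)" for k
    by (rule integrable_times_slab[OF meas C])
  have int_V: "(LINT x|lborel. (V x - v R) * slab k x) = slab_energy V k - v R"
    "integrable lborel (\<lambda>x. (V x - v R) * slab k x)"
    if "0 < k" for k
    using int[of k] integrable_slab[of k, where 'n = 'n] integral_slab[OF that, where 'n = 'n]
    by (auto simp: slab_energy_def left_diff_distrib)
  have w_eq: "(V x - v R) * w x = a * ((V x - v R) * slab h0 x) + b * ((V x - v R) * slab h1 x)" for x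
    by (simp add: w_def algebra_simps)
  have int_w: "integrable lborel (\<lambda>x. (V x - v R) * w x)"
    unfolding w_eq using int_V(2)[of h0] int_V(2)[of h1] h by simp
  \<comment> \<open>Inside the ball, \<open>V x - v R\<close> is negative and \<open>w\<close> is at
    most \<open>a * h0 + b * h1 = h\<close>. Outside, \<open>V x - v R\<close> is nonnegative and
    \<open>slab h\<close> vanishes. The null set \<open>{0}\<close> is left out because
    \<open>v\<close> is known to increase only on positive radii.\<close>
  have le: "(V x - v R) * slab h x \<le> (V x - v R) * w x" if "x \<noteq> 0" for x
  proof (cases "norm x < R")
    case True
    then have "V x < v R"
      using that by (auto simp: V intro: v)
    moreover have "w x \<le> slab h x"
      using True h a by (auto simp: w_def slab_eq h_def R_def)
    ultimately show ?thesis
      by (intro mult_left_mono_neg) auto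
  next
    case False
    then have "v R \<le> V x"
      using R v[of R "norm x"] by (cases "norm x = R") (auto simp: V)
    moreover have "0 \<le> w x"
      using h a by (simp add: w_def slab_nonneg)
    moreover have "slab h x = 0"
      using False by (simp add: slab_eq R_def)
    ultimately show ?thesis by simp
  qed
  have "(LINT x|lborel. (V x - v R) * slab h x) < (LINT x|lborel. (V x - v R) * w x)"
  proof (rule integral_strict_mono_AE)
    show "AE x in lborel. (V x - v R) * slab h x \<le> (V x - v R) * w x"
      using AE_lborel_singleton[of 0] by (rule eventually_mono) (rule le)
    show "\<not> (AE x in lborel. (V x - v R) * slab h x = (V x - v R) * w x)"
    proof
      \<comment> \<open>On this annulus the inequality is strict: \<open>slab h\<close> vanishes
        there while the wider slab of height \<open>h0\<close> does not. It is nonempty because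
        \<open>h0 < h\<close> makes the radius for \<open>h0\<close> larger than
        \<open>R\<close>.\<close>
      define A where "A = {x :: real ^ 'n. R < norm x \<and> norm x < radius TYPE('n) h0}"
      assume "AE x in lborel. (V x - v R) * slab h x = (V x - v R) * w x"
      then have "AE x in lborel. x \<notin> A"
      proof (rule eventually_mono)
        fix x assume eq: "(V x - v R) * slab h x = (V x - v R) * w x"
        show "x \<notin> A"
        proof
          assume x: "x \<in> A"
          then have "v R < V x"
            using R by (auto simp: A_def V intro: v)
          moreover have "slab h x = 0" "slab h0 x = h0"
            using x by (auto simp: A_def slab_eq R_def)
          moreover have "0 < w x"
            using h a \<open>slab h0 x = h0\<close> slab_nonneg[of h1 x] by (simp add: w_def add_pos_nonneg)
          ultimately show False
            using eq by simp
        qed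
      qed
      moreover have "open A"
        unfolding A_def by (intro open_Collect_conj open_Collect_less continuous_intros)
      ultimately have "emeasure lborel A = 0"
        using AE_iff_null_sets[of A lborel] by (simp add: null_sets_def)
      moreover obtain x :: "real ^ 'n" where "norm x = (R + radius TYPE('n) h0) / 2"
        using vector_choose_size[of "(R + radius TYPE('n) h0) / 2"] R by auto
      then have "x \<in> A"
        using R by (auto simp: A_def)
      ultimately show False
        using open_lborel_pos[OF \<open>open A\<close>] by fastforce
    qed
  qed (use int_V(2)[OF hpos] int_w in auto)
  also have "\<dots> = a * (slab_energy V h0 - v R) + b * (slab_energy V h1 - v R)"
    unfolding w_eq using int_V[of h0] int_V[of h1] h by simp
  also have "\<dots> = a * slab_energy V h0 + b * slab_energy V h1 - v R"
    using arg_cong[OF a(3), of "\<lambda>c. c * v R"] by (simp add: algebra_simps)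
  finally show ?thesis
    unfolding int_V(1)[OF hpos] by (simp add: h_def)
qed

lemma slab_energy_strict_convex:
  fixes V :: "real ^ 'n::finite \<Rightarrow> real"
  assumes "V \<in> borel_measurable borel" and "\<And>x. \<bar>V x\<bar> \<le> C"
    and "\<And>x. V x = v (norm x)" and "\<And>r s. 0 < r \<Longrightarrow> r < s \<Longrightarrow> v r < v s"
    and "0 < h0" "0 < h1" "h0 \<noteq> h1" and "0 < a" "0 < b" "a + b = 1"
  shows "slab_energy V (a * h0 + b * h1) < a * slab_energy V h0 + b * slab_energy V h1"
proof (cases "h0 < h1")
  case True
  with assms show ?thesis
    by (intro slab_energy_strict_convex_less[where v = v]) auto
next
  case False
  with assms have "slab_energy V (b * h1 + a * h0) < b * slab_energy V h1 + a * slab_energy V h0"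
    by (intro slab_energy_strict_convex_less[where v = v]) auto
  then show ?thesis by (simp add: add.commute)
qed

section \<open>Energy of a superposition of slabs\<close>

text \<open>Fubini applies because each slab has unit mass and \<open>V\<close> is bounded, so the
  inner integrals of the absolute value are at most \<open>C\<close> and live on the unit interval.
  Setting \<open>e\<close> to zero elsewhere allows integration over the whole line, as
  \<open>slab 0\<close> vanishes.\<close>

lemma energy_layer_cake:
  fixes V :: "real ^ 'n::finite \<Rightarrow> real" and e :: "real \<Rightarrow> real"
  assumes meas [measurable]: "V \<in> borel_measurable borel" and C: "\<And>x. \<bar>V x\<bar> \<le> C"
    and e [measurable]: "e \<in> borel_measurable borel"
    and pos: "\<And>m. m \<in> {0<..<1} \<Longrightarrow> 0 < e m" and zero: "\<And>m. m \<notin> {0<..<1} \<Longrightarrow> e m = 0"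
  shows "(LINT x|lborel. V x * (LINT m|lborel. slab (e m) x)) = (LINT m|lborel. slab_energy V (e m))"
    and "integrable lborel (\<lambda>m. slab_energy V (e m))"
proof -
  have int_ind: "integrable lborel (\<lambda>m::real. \<bar>C\<bar> * indicator {0<..<1} m)"
    by (intro integrable_mult_right) (simp add: integrable_indicator_iff)
  have [measurable]: "(\<lambda>m. slab_energy V (e m)) \<in> borel_measurable borel"
    unfolding slab_energy_def by measurable
  show int1: "integrable lborel (\<lambda>m. slab_energy V (e m))"
  proof (rule Bochner_Integration.integrable_bound[OF int_ind])
    show "AE m in lborel. norm (slab_energy V (e m)) \<le> norm (\<bar>C\<bar> * indicator {0<..<1} m)"
    proof (rule AE_I2)
      fix m :: real
      show "norm (slab_energy V (e m)) \<le> norm (\<bar>C\<bar> * indicator {0<..<1} m)"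
      proof (cases "m \<in> {0<..<1}")
        case True
        then show ?thesis
          using abs_slab_energy_le[OF meas C pos[OF True]] by simp
      qed (simp add: zero slab_energy_def)
    qed
  qed measurable
  have "integrable (lborel \<Otimes>\<^sub>M lborel) (\<lambda>(m, x). V x * slab (e m) x)"
  proof (rule lborel_pair.Fubini_integrable)
    \<comment> \<open>Slabs are nonnegative, so the absolute integral is again a slab energy, now
      for \<open>\<bar>V x\<bar>\<close>, and the same bound \<open>C\<close> controls it.\<close>
    have bound: "(LINT x|lborel. norm (V x * slab (e m) x)) = slab_energy (\<lambda>x. \<bar>V x\<bar>) (e m)" for m
    proof -
      have "0 \<le> e m"
        using pos[of m] zero[of m] by (cases "m \<in> {0<..<1}") auto
      then show ?thesis
        unfolding slab_energy_def
        by (intro Bochner_Integration.integral_cong) (auto simp: abs_mult slab_nonneg)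
    qed
    have "integrable lborel (\<lambda>m. slab_energy (\<lambda>x. \<bar>V x\<bar>) (e m))"
    proof (rule Bochner_Integration.integrable_bound[OF int_ind])
      show "(\<lambda>m. slab_energy (\<lambda>x. \<bar>V x\<bar>) (e m)) \<in> borel_measurable lborel"
        unfolding slab_energy_def by measurable
      show "AE m in lborel. norm (slab_energy (\<lambda>x. \<bar>V x\<bar>) (e m)) \<le> norm (\<bar>C\<bar> * indicator {0<..<1} m)"
      proof (rule AE_I2)
        fix m :: real
        show "norm (slab_energy (\<lambda>x. \<bar>V x\<bar>) (e m)) \<le> norm (\<bar>C\<bar> * indicator {0<..<1} m)"
        proof (cases "m \<in> {0<..<1}")
          case True
          then show ?thesis
            using abs_slab_energy_le[of "\<lambda>x. \<bar>V x\<bar>" C, OF _ _ pos[OF True]] C by simp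
        qed (simp add: zero slab_energy_def)
      qed
    qed
    then show "integrable lborel (\<lambda>m. LINT x|lborel. norm (case (m, x) of (m, x) \<Rightarrow> V x * slab (e m) x))"
      using bound by simp
    show "AE m in lborel. integrable lborel (\<lambda>x. case (m, x) of (m, x) \<Rightarrow> V x * slab (e m) x)"
      using integrable_times_slab[OF meas C] by simp
  qed measurable
  from lborel_pair.Fubini_integral[OF this]
  show "(LINT x|lborel. V x * (LINT m|lborel. slab (e m) x)) = (LINT m|lborel. slab_energy V (e m))"
    by (simp add: slab_energy_def)
qed

section \<open>Slopes determine heights, and heights determine densities\<close>

text \<open>Bisecting the interval halves the bound.\<close>

lemma constant_if_difference_le_mono:
  fixes D E :: "real \<Rightarrow> real"
  assumes le: "\<And>x y. a < x \<Longrightarrow> x < y \<Longrightarrow> y < b \<Longrightarrow> \<bar>D y - D x\<bar> \<le> (y - x) * (E y - E x)"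
    and xy: "a < x" "x < y" "y < b"
  shows "D x = D y"
proof -
  have *: "\<bar>D y - D x\<bar> \<le> (y - x) * (E y - E x) / 2 ^ k" if "a < x" "x < y" "y < b" for k x y
    using that
  proof (induction k arbitrary: x y)
    case 0
    then show ?case using le by simp
  next
    case (Suc k)
    define z where "z = (x + y) / 2"
    have z: "x < z" "z < y" "z - x = (y - x) / 2" "y - z = (y - x) / 2"
      using Suc.prems by (auto simp: z_def field_simps)
    have "\<bar>D y - D x\<bar> \<le> \<bar>D y - D z\<bar> + \<bar>D z - D x\<bar>"
      by linarith
    also have "\<dots> \<le> (y - z) * (E y - E z) / 2 ^ k + (z - x) * (E z - E x) / 2 ^ k"
      using Suc.IH[of z y] Suc.IH[of x z] Suc.prems z(1,2) by (intro add_mono) auto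
    also have "\<dots> = (y - x) * (E y - E x) / 2 ^ Suc k"
      unfolding z(3,4) by (simp add: field_simps)
    finally show ?case .
  qed
  have "(\<lambda>k. (y - x) * (E y - E x) * (1 / 2) ^ k) \<longlonglongrightarrow> (y - x) * (E y - E x) * 0"
    by (intro tendsto_mult_left LIMSEQ_power_zero) simp
  then have "\<bar>D y - D x\<bar> \<le> 0"
    by (intro LIMSEQ_le_const) (use *[OF xy] in \<open>auto simp: power_one_over\<close>)
  then show ?thesis by simp
qed

lemma AE_lborel_dense:
  fixes x y :: real
  assumes "AE m in lborel. P m" "x < y"
  obtains z where "x < z" "z < y" "P z"
proof (rule ccontr)
  assume "\<not> thesis"
  then have "\<And>m. P m \<Longrightarrow> m \<notin> {x<..<y}"
    using that by auto
  then have "AE m in lborel. m \<notin> {x<..<y}"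
    using assms(1) by (auto elim: eventually_mono)
  then have "emeasure lborel {x<..<y} = 0"
    using AE_iff_null_sets[of "{x<..<y}" lborel] by (simp add: null_sets_def)
  then show False
    using assms(2) by simp
qed

text \<open>Between any two points lies a point of equal slopes. Comparing increments there bounds
  those of the difference \<open>D\<close> by \<open>(y - x) * (E y - E x)\<close>, so bisection
  makes \<open>D\<close> constant, and both heights tend to \<open>0\<close> at
  \<open>0\<close>.\<close>

lemma height_eq_if_slope_AE_eq:
  assumes "symmetric_density f0" "symmetric_density f1"
    and ae: "AE m in lborel. m \<in> {0<..<1} \<longrightarrow> symmetric_density.slope f0 m = symmetric_density.slope f1 m"
    and m: "0 < m" "m < 1"
  shows "height f0 m = height f1 m"
proof -
  interpret a: symmetric_density f0 by fact
  interpret b: symmetric_density f1 by fact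
  define D where "D m = height f0 m - height f1 m" for m
  define E where "E m = a.slope m + b.slope m" for m
  have mono: "a.slope x \<le> a.slope y" "b.slope x \<le> b.slope y" if "0 < x" "x < y" "y < 1" for x y
    using that mono_onD[OF a.slope_mono, of x y] mono_onD[OF b.slope_mono, of x y] by auto
  have "\<bar>D y - D x\<bar> \<le> (y - x) * (E y - E x)" if xy: "0 < x" "x < y" "y < 1" for x y
  proof -
    obtain z where z: "x < z" "z < y" and "z \<in> {0<..<1} \<longrightarrow> a.slope z = b.slope z"
      using AE_lborel_dense[OF ae xy(2)] by blast
    then have eq: "a.slope z = b.slope z"
      using xy by auto
    \<comment> \<open>With \<open>s\<close> the common slope at \<open>z\<close>, both height
      increments lie between \<open>(y - z) * s\<close> and \<open>y - z\<close> times the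
      respective slope at \<open>y\<close>, while \<open>E z = 2 * s\<close>.\<close>
    have "\<bar>D y - D z\<bar> \<le> (y - z) * (E y - E z)"
    proof -
      have "(y - z) * a.slope z \<le> (y - z) * a.slope y" "(y - z) * b.slope z \<le> (y - z) * b.slope y"
        using mono[of z y] z xy by (auto intro: mult_left_mono)
      with a.height_diff[of z y] b.height_diff[of z y] z xy eq show ?thesis
        unfolding D_def E_def abs_le_iff by (simp add: distrib_left right_diff_distrib)
    qed
    moreover have "\<bar>D z - D x\<bar> \<le> (z - x) * (E z - E x)"
    proof -
      have "(z - x) * a.slope x \<le> (z - x) * a.slope z" "(z - x) * b.slope x \<le> (z - x) * b.slope z"
        using mono[of x z] z xy by (auto intro: mult_left_mono)
      with a.height_diff[of x z] b.height_diff[of x z] z xy eq show ?thesis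
        unfolding D_def E_def abs_le_iff by (simp add: distrib_left right_diff_distrib)
    qed
    \<comment> \<open>Enlarging both lengths to \<open>y - x\<close> makes the increments of
      \<open>E\<close> telescope.\<close>
    moreover have "(y - z) * (E y - E z) + (z - x) * (E z - E x) \<le> (y - x) * (E y - E z) + (y - x) * (E z - E x)"
      using mono[of z y] mono[of x z] z xy
      by (intro add_mono mult_right_mono) (auto simp: E_def)
    ultimately show ?thesis
      by (simp add: algebra_simps)
  qed
  then have const: "D x = D y" if "0 < x" "x < y" "y < 1" for x y
    using constant_if_difference_le_mono[of 0 1 D E x y] that by blast
  have "\<bar>D m\<bar> < \<epsilon>" if eps: "0 < \<epsilon>" for \<epsilon>
  proof -
    obtain d0 where d0: "d0 > 0" "\<And>m. 0 < m \<Longrightarrow> m < d0 \<Longrightarrow> m < 1 \<Longrightarrow> height f0 m < \<epsilon>"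
      using a.height_less_near_zero[OF eps] by blast
    obtain d1 where d1: "d1 > 0" "\<And>m. 0 < m \<Longrightarrow> m < d1 \<Longrightarrow> m < 1 \<Longrightarrow> height f1 m < \<epsilon>"
      using b.height_less_near_zero[OF eps] by blast
    define l where "l = min m (min d0 d1) / 2"
    have l: "0 < l" "l < m" "l < d0" "l < d1" "l < 1"
      using m d0(1) d1(1) by (auto simp: l_def min_def)
    have "D m = D l"
      using const[of l m] l m by simp
    then show ?thesis
      using d0(2)[of l] d1(2)[of l] a.height_pos[of l] b.height_pos[of l] l by (auto simp: D_def)
  qed
  then have "D m = 0"
    by (metis less_irrefl zero_less_abs_iff)
  then show ?thesis
    by (simp add: D_def)
qed

text \<open>Equal heights give equal truncated masses. If \<open>f0 x < h1 < h2 < f1 x\<close>,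
  comparing mass increments shows that the superlevel set of \<open>f1\<close> at \<open>h2\<close>
  is no larger than that of \<open>f0\<close> at \<open>h1\<close>. The latter lies in the ball of
  radius \<open>norm x\<close>, while by continuity the former contains a larger ball.\<close>

lemma density_le_if_height_eq:
  fixes f0 f1 :: "real ^ 'n \<Rightarrow> real"
  assumes "symmetric_density f0" "symmetric_density f1"
    and eq: "\<And>m. 0 < m \<Longrightarrow> m < 1 \<Longrightarrow> height f0 m = height f1 m"
  shows "f1 x \<le> f0 x"
proof (rule ccontr)
  interpret a: symmetric_density f0 by fact
  interpret b: symmetric_density f1 by fact
  assume "\<not> f1 x \<le> f0 x"
  then have less: "f0 x < f1 x" by simp
  have layers: "h < f0 0 \<and> a.layer h = b.layer h" if h: "0 < h" "h < f1 0" for h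
  proof -
    note l = b.layer_in_unit[OF h]
    have "height f0 (b.layer h) = h"
      using eq l by simp
    then show ?thesis
      using a.layer_height[of "b.layer h"] a.height_less[of "b.layer h"] l by simp
  qed
  obtain h1 where h1: "f0 x < h1" "h1 < f1 x"
    using dense[OF less] by blast
  obtain h2 where h2: "h1 < h2" "h2 < f1 x"
    using dense[OF h1(2)] by blast
  have pos: "0 < h1" "0 < h2"
    using h1 h2 a.nonneg[of x] by auto
  have lt: "h1 < f1 0" "h2 < f1 0"
    using h1 h2 b.le_centre[of x] by auto
  \<comment> \<open>The common mass between heights \<open>h1\<close> and \<open>h2\<close> is
    bounded below through \<open>f1\<close> and above through \<open>f0\<close>.\<close>
  have "(h2 - h1) * b.superlevel h2 \<le> (h2 - h1) * a.superlevel h1"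
    using b.layer_diff(1)[OF pos(1) h2(1)] a.layer_diff(2)[OF pos(1) h2(1)]
      layers[OF pos(1) lt(1)] layers[OF pos(2) lt(2)] by simp
  then have "b.superlevel h2 \<le> a.superlevel h1"
    using h2 by simp
  also have "a.superlevel h1 \<le> measure lborel (ball (0 :: real ^ 'n) (norm x))"
    unfolding a.superlevel_def
  proof (rule measure_mono_fmeasurable)
    show "{y. h1 < f0 y} \<subseteq> ball 0 (norm x)"
    proof
      fix y assume "y \<in> {y. h1 < f0 y}"
      then have "\<not> norm x \<le> norm y"
        using a.antimono_norm[of x y] h1 by auto
      then show "y \<in> ball 0 (norm x)" by simp
    qed
  qed (use emeasure_lborel_ball_finite[of "0 :: real ^ 'n" "norm x"] in \<open>auto simp: fmeasurable_def\<close>)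
  finally have le: "b.superlevel h2 \<le> measure lborel (ball (0 :: real ^ 'n) (norm x))" .
  have "x \<in> {y. h2 < f1 y}"
    using h2 by simp
  then obtain r where r: "r > 0" "ball x r \<subseteq> {y. h2 < f1 y}"
    using b.open_superlevel[of h2] open_contains_ball by blast
  \<comment> \<open>A point slightly farther out than \<open>x\<close>, still in the open superlevel
    set. It is found along the ray through \<open>x\<close>, or in an arbitrary direction if
    \<open>x\<close> is the origin.\<close>
  obtain y where y: "norm y = norm x + r / 2" "h2 < f1 y"
  proof (cases "x = 0")
    case True
    obtain y :: "real ^ 'n" where "norm y = r / 2"
      using vector_choose_size[of "r / 2"] r by auto
    with True r that[of y] show ?thesis by (auto simp: dist_norm subset_iff)
  next
    case False
    define y where "y = (1 + r / 2 / norm x) *\<^sub>R x"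
    have "dist x y = r / 2"
      using False r by (simp add: y_def dist_norm scaleR_left_distrib)
    moreover have "norm y = norm x + r / 2"
    proof -
      have "norm y = (1 + r / 2 / norm x) * norm x"
        using r by (simp add: y_def)
      also have "\<dots> = norm x + r / 2"
        using False by (simp add: distrib_right)
      finally show ?thesis .
    qed
    moreover have "y \<in> ball x r"
      using \<open>dist x y = r / 2\<close> r by simp
    ultimately show ?thesis
      using that[of y] r by blast
  qed
  have "measure lborel (ball (0 :: real ^ 'n) (norm y)) \<le> b.superlevel h2"
    unfolding b.superlevel_def
  proof (rule measure_mono_fmeasurable)
    show "ball 0 (norm y) \<subseteq> {z. h2 < f1 z}"
    proof
      fix z :: "real ^ 'n" assume "z \<in> ball 0 (norm y)"
      then have "f1 y \<le> f1 z"
        using b.antimono_norm[of z y] by simp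
      with y show "z \<in> {z. h2 < f1 z}" by simp
    qed
  qed (use b.superlevel_finite[OF pos(2)] in \<open>auto simp: fmeasurable_def\<close>)
  with le have "measure lborel (ball (0 :: real ^ 'n) (norm y)) \<le> measure lborel (ball (0 :: real ^ 'n) (norm x))"
    by linarith
  moreover have "norm x ^ DIM(real ^ 'n) < norm y ^ DIM(real ^ 'n)"
    using r y(1) by (intro power_strict_mono) auto
  moreover have "0 < unit_ball_vol (real DIM(real ^ 'n))"
    by simp
  moreover have "measure lborel (ball (0 :: real ^ 'n) (norm z)) = unit_ball_vol (real DIM(real ^ 'n)) * norm z ^ DIM(real ^ 'n)"
    for z :: "real ^ 'n"
    by (rule content_ball) simp
  ultimately show False
    by (smt (verit) mult_strict_left_mono)
qed

section \<open>Interpolated slopes and strict convexity of the energy\<close>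

text \<open>Represents the derivative of the interpolated height function almost everywhere on the
  unit interval. The indicator removes the meaningless values of \<open>slope\<close> elsewhere, in
  the form that \<open>energy_layer_cake\<close> expects.\<close>

definition slope_interpolation ::
    "(real ^ 'n::finite \<Rightarrow> real) \<Rightarrow> (real ^ 'n \<Rightarrow> real) \<Rightarrow> real \<Rightarrow> real \<Rightarrow> real" where
  "slope_interpolation f0 f1 t m = indicator {0<..<1} m *
     ((1 - t) * symmetric_density.slope f0 m + t * symmetric_density.slope f1 m)"

lemma (in symmetric_density) measurable_slope_indicator:
  "(\<lambda>m. indicator {0<..<1} m * slope m) \<in> borel_measurable borel"
  using borel_measurable_mono_on_fnc[OF slope_mono]
  by (simp add: borel_measurable_restrict_space_iff)

context
  fixes f0 f1 :: "real ^ 'n::finite \<Rightarrow> real"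
  assumes f0: "symmetric_density f0" and f1: "symmetric_density f1"
begin

interpretation a: symmetric_density f0 by (fact f0)
interpretation b: symmetric_density f1 by (fact f1)

lemma measurable_slope_interpolation: "slope_interpolation f0 f1 t \<in> borel_measurable borel"
proof -
  have "slope_interpolation f0 f1 t = (\<lambda>m. (1 - t) * (indicator {0<..<1} m * a.slope m)
      + t * (indicator {0<..<1} m * b.slope m))"
    by (auto simp: slope_interpolation_def algebra_simps)
  then show ?thesis
    using a.measurable_slope_indicator b.measurable_slope_indicator by simp
qed

lemma slope_interpolation_pos:
  assumes "t \<in> {0..1}" "m \<in> {0<..<1}"
  shows "0 < slope_interpolation f0 f1 t m"
proof -
  have "0 < a.slope m" "0 < b.slope m"
    using assms a.slope_pos b.slope_pos by auto
  then have "0 < (1 - t) * a.slope m + t * b.slope m"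
    using assms(1) by (cases "t = 0") (auto intro: add_nonneg_pos)
  then show ?thesis
    using assms(2) by (simp add: slope_interpolation_def)
qed

text \<open>Where both slopes are continuous, \<open>deriv\<close> of the interpolated height is the
  interpolated slope; the countably many other points do not affect the integral.\<close>

lemma height_interpolation_eq:
  "height_interpolation f0 f1 t x = (LINT m|lborel. slab (slope_interpolation f0 f1 t m) x)"
  unfolding height_interpolation_def of_height_def set_lebesgue_integral_def
proof (rule integral_discrete_difference
    [where X = "{m \<in> {0<..<1}. \<not> isCont a.slope m} \<union> {m \<in> {0<..<1}. \<not> isCont b.slope m}"])
  show "countable ({m \<in> {0<..<1}. \<not> isCont a.slope m} \<union> {m \<in> {0<..<1}. \<not> isCont b.slope m})"
    using a.countable_discontinuities b.countable_discontinuities by simp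
next
  fix m assume m: "m \<notin> {m \<in> {0<..<1}. \<not> isCont a.slope m} \<union> {m \<in> {0<..<1}. \<not> isCont b.slope m}"
  let ?H = "\<lambda>m. (1 - t) * height f0 m + t * height f1 m"
  show "indicator {0<..<1} m *\<^sub>R
        (indicator (ball 0 ((measure lborel (ball (0 :: real ^ 'n) 1) * deriv ?H m)
           powr (- 1 / real CARD('n)))) x * deriv ?H m)
      = slab (slope_interpolation f0 f1 t m) x"
  proof (cases "m \<in> {0<..<1}")
    case True
    then have "(height f0 has_real_derivative a.slope m) (at m)"
      "(height f1 has_real_derivative b.slope m) (at m)"
      using m by (auto intro: a.DERIV_height b.DERIV_height)
    then have "(?H has_real_derivative (1 - t) * a.slope m + t * b.slope m) (at m)"
      by (auto intro!: derivative_eq_intros)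
    then have "deriv ?H m = slope_interpolation f0 f1 t m"
      using True by (simp add: DERIV_imp_deriv slope_interpolation_def)
    then show ?thesis
      using True by (simp add: slab_def radius_def)
  qed (simp add: slope_interpolation_def)
qed auto

lemma slopes_differ:
  assumes "f0 \<noteq> f1"
  shows "\<not> (AE m in lborel. m \<in> {0<..<1} \<longrightarrow> a.slope m = b.slope m)"
proof
  assume ae: "AE m in lborel. m \<in> {0<..<1} \<longrightarrow> a.slope m = b.slope m"
  have eq: "height f0 m = height f1 m" if "0 < m" "m < 1" for m
    using height_eq_if_slope_AE_eq[OF f0 f1 ae that] .
  have "f0 x = f1 x" for x
    using density_le_if_height_eq[OF f0 f1 eq, of x] density_le_if_height_eq[OF f1 f0 eq[symmetric], of x]
    by simp
  with assms show False by auto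
qed

end

text \<open>Strict convexity is obtained on the closed interval, which contains the open one,
  because the interpolated slopes are positive at both endpoints as well.\<close>

theorem proposition5p4:
  fixes V f0 f1 :: "real ^ 'n \<Rightarrow> real"
  assumes "smooth V" and "bounded (range V)" and "increasing_radially_symmetric V"
    and "continuous_on UNIV f0" and "continuous_on UNIV f1"
    and "f0 \<noteq> f1"
    and "\<And>x. f0 x \<ge> 0" and "\<And>x. f1 x \<ge> 0"
    and "symmetric_decreasing f0" and "symmetric_decreasing f1"
    and "unit_mass f0" and "unit_mass f1"
  shows "strictly_convex_on {0..1}
           (\<lambda>t. LINT x|lborel. V x * height_interpolation f0 f1 t x)"
proof -
  have f0: "symmetric_density f0" and f1: "symmetric_density f1"
    using assms by (simp_all add: symmetric_density_def)
  let ?e = "slope_interpolation f0 f1"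
  have "times_cont_differentiable 0 V"
    using assms(1) unfolding smooth_def by blast
  then have V_meas: "V \<in> borel_measurable borel"
    by (simp add: borel_measurable_continuous_onI)
  obtain C where C: "\<And>x. \<bar>V x\<bar> \<le> C"
    using assms(2) by (auto simp: bounded_iff)
  obtain v v' where v: "\<And>x. V x = v (norm x)"
    and v': "\<And>r. r > 0 \<Longrightarrow> (v has_real_derivative v' r) (at r) \<and> v' r > 0"
    using assms(3) unfolding increasing_radially_symmetric_def by blast
  have v_mono: "v r < v s" if "0 < r" "r < s" for r s
  proof (rule DERIV_pos_imp_increasing[OF that(2)])
    fix x assume "r \<le> x" "x \<le> s"
    with that have "0 < x" by simp
    from v'[OF this] show "\<exists>y. (v has_real_derivative y) (at x) \<and> 0 < y"
      by blast
  qed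
  have zero: "?e t m = 0" if "m \<notin> {0<..<1}" for t m
    using that by (simp add: slope_interpolation_def)
  have energy: "(LINT x|lborel. V x * height_interpolation f0 f1 t x) = (LINT m|lborel. slab_energy V (?e t m))"
    "integrable lborel (\<lambda>m. slab_energy V (?e t m))" if "t \<in> {0..1}" for t
    unfolding height_interpolation_eq[OF f0 f1]
    using energy_layer_cake[OF V_meas C measurable_slope_interpolation[OF f0 f1]
        slope_interpolation_pos[OF f0 f1 that] zero]
    by blast+
  show ?thesis
    unfolding strictly_convex_on_def
  proof (intro conjI ballI impI)
    fix s t u :: real
    assume st: "s \<in> {0..1}" "t \<in> {0..1}" and u: "u \<in> {0<..<1}" and "s \<noteq> t"
    let ?w = "(1 - u) * s + u * t"
    have w: "?w \<in> {0..1}"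
      using convexD[OF convex_real_interval(5)[of 0 1] st, of "1 - u" u] u by simp
    have comb: "?e ?w m = (1 - u) * ?e s m + u * ?e t m" for m
      unfolding slope_interpolation_def by (simp add: algebra_simps)
    have strict: "slab_energy V (?e ?w m) < (1 - u) * slab_energy V (?e s m) + u * slab_energy V (?e t m)"
      if "m \<in> {0<..<1}" "?e s m \<noteq> ?e t m" for m
      unfolding comb
      by (rule slab_energy_strict_convex[OF V_meas C v v_mono])
        (use that u st slope_interpolation_pos[OF f0 f1] in auto)
    have weak: "slab_energy V (?e ?w m) = (1 - u) * slab_energy V (?e s m) + u * slab_energy V (?e t m)"
      if "?e s m = ?e t m" for m
      unfolding comb that by (simp add: algebra_simps)
    have ne: "?e s m \<noteq> ?e t m"
      if "m \<in> {0<..<1}" "symmetric_density.slope f0 m \<noteq> symmetric_density.slope f1 m" for m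
    proof -
      \<comment> \<open>The interpolated slope is affine in its parameter, with leading coefficient
        the difference of the two original slopes.\<close>
      have "?e s m - ?e t m = (s - t) * (symmetric_density.slope f1 m - symmetric_density.slope f0 m)"
        using that(1) by (simp add: slope_interpolation_def algebra_simps)
      then show ?thesis
        using that(2) \<open>s \<noteq> t\<close> by auto
    qed
    have "(LINT m|lborel. slab_energy V (?e ?w m))
        < (LINT m|lborel. (1 - u) * slab_energy V (?e s m) + u * slab_energy V (?e t m))"
    proof (rule integral_strict_mono_AE)
      show "AE m in lborel. slab_energy V (?e ?w m) \<le> (1 - u) * slab_energy V (?e s m) + u * slab_energy V (?e t m)"
      proof (rule AE_I2)
        fix m
        show "slab_energy V (?e ?w m) \<le> (1 - u) * slab_energy V (?e s m) + u * slab_energy V (?e t m)"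
          \<comment> \<open>Outside the unit interval both interpolated slopes are zero, so
            \<open>weak\<close> covers that case too.\<close>
          using strict[of m] weak[of m] zero by (cases "m \<in> {0<..<1} \<and> ?e s m \<noteq> ?e t m") force+
      qed
      show "\<not> (AE m in lborel. slab_energy V (?e ?w m)
          = (1 - u) * slab_energy V (?e s m) + u * slab_energy V (?e t m))"
      proof
        assume "AE m in lborel. slab_energy V (?e ?w m)
          = (1 - u) * slab_energy V (?e s m) + u * slab_energy V (?e t m)"
        then have "AE m in lborel. m \<in> {0<..<1} \<longrightarrow>
            symmetric_density.slope f0 m = symmetric_density.slope f1 m"
          by (rule eventually_mono) (use strict ne in force)
        with slopes_differ[OF f0 f1 \<open>f0 \<noteq> f1\<close>] show False ..
      qed
    qed (use energy(2) w st in auto)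
    also have "\<dots> = (1 - u) * (LINT m|lborel. slab_energy V (?e s m)) + u * (LINT m|lborel. slab_energy V (?e t m))"
      using energy(2) st by simp
    finally show "(LINT x|lborel. V x * height_interpolation f0 f1 ?w x)
        < (1 - u) * (LINT x|lborel. V x * height_interpolation f0 f1 s x)
          + u * (LINT x|lborel. V x * height_interpolation f0 f1 t x)"
      using energy(1) w st by simp
  qed (rule convex_real_interval)
qed

end
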